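(* Let $H_1,H_2$ be real Hilbert spaces. For each $i\in\{1,2\}$, let $C_i$ be a nonempty, closed and convex subset of $H_i$; let $f_i:H_i\to H_i$ be $\alpha_i$-strongly monotone with respect to $g_i$ and $\beta_i$-Lipschitz continuous, where $g_i:H_i\to H_i$ is $\delta_i$-Lipschitz continuous and $g_i-I_i$ is $\sigma_i$-strongly monotone, $I_i$ being the identity operator on $H_i$ (all of $\alpha_i,\beta_i,\delta_i,\sigma_i$ are positive constants). Let $A:H_1\to H_2$ be a bounded linear operator with adjoint $A^*$. Suppose $x_1^*\in H_1$ is a solution of the split general variational inequality problem, i.e. $g_1(x_1^* )\in C_1$ and $$\langle f_1(x_1^* ),x_1-g_1(x_1^* )\rangle\ge 0\quad\text{for all }x_1\in C_1,$$ and $x_2^*=Ax_1^*$ satisfies $g_2(x_2^* )\in C_2$ and $$\langle f_2(x_2^* ),x_2-g_2(x_2^* )\rangle\ge 0\quad\text{for all }x_2\in C_2.$$ Let $\{\alpha^n\}\subseteq(0,1)$ be a sequence with $\sum_{n=1}^\infty\alpha^n=+\infty$ (here $n$ is an index, not a power), let $\rho_1,\rho_2,\gamma>0$, let $x_1^0\in H_1$ be given, and let $\{x_1^n\}$, $\{y^n\}$, $\{z^n\}$ be generated, for $n=0,1,2,\dots$, by $$g_1(y^n)=P_{C_1}\big(g_1(x_1^n)-\rho_1f_1(x_1^n)\big),$$ $$g_2(z^n)=P_{C_2}\big(g_2(Ay^n)-\rho_2f_2(Ay^n)\big),$$ $$x_1^{n+1}=(1-\alpha^n)x_1^n+\alpha^n\big[y^n+\gamma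 A^*(z^n-Ay^n)\big].$$ Suppose that the constants satisfy $$\left|\rho_1-\frac{\alpha_1}{\beta_1^2}\right|<\frac{\sqrt{\alpha_1^2-\beta_1^2(\delta_1^2-k_1^2)}}{\beta_1^2},$$ $$\alpha_1>\beta_1\sqrt{\delta_1^2-k_1^2},\qquad k_1=\frac{\sqrt{2\sigma_1+1}}{1+2\theta_2},\qquad \delta_1>|k_1|,$$ $$0<\theta_2=\sqrt{\frac{\delta_2^2-2\rho_2\alpha_2+\rho_2^2\beta_2^2}{2\sigma_2+1}},\qquad \rho_2>0,\qquad \gamma\in\left(0,\frac{2}{\|A\|^2}\right).$$ Then the sequence $\{x_1^n\}$ converges strongly (i.e. in norm) to $x_1^*$.
   Context: For a nonempty closed convex subset $C$ of a real Hilbert space $H$, $P_C:H\to C$ denotes the metric projection: $P_C(x)$ is the unique point of $C$ nearest to $x$. Let $f,g:H\to H$. The mapping $f$ is $\alpha$-strongly monotone ($\alpha>0$) if $\langle f(x)-f(\bar x),x-\bar x\rangle\ge\alpha\|x-\bar x\|^2$ for all $x,\bar x\in H$; it is $\alpha$-strongly monotone with respect to $g$ ($\alpha>0$) if $\langle f(x)-f(\bar x),g(x)-g(\bar x)\rangle\ge\alpha\|x-\bar x\|^2$ for all $x,\bar x\in H$; it is $\beta$-Lipschitz continuous ($\beta>0$) if $\|f(x)-f(\bar x)\|\le\beta\|x-\bar x\|$ for all $x,\bar x\in H$. *)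

theory Defs
  imports "HOL-Analysis.Analysis"
begin

text \<open>
  Real Hilbert spaces are rendered by the sort \<open>{real_inner, complete_space}\<close>.
  The library's \<open>closest_point\<close> requires \<open>heine_borel\<close>, hence finite dimension, so the metric
  projection is defined here. It is meaningful for nonempty closed convex \<open>C\<close>, where the nearest
  point exists and is unique.
\<close>

definition metric_proj :: "'a::{real_inner, complete_space} set \<Rightarrow> 'a \<Rightarrow> 'a" where
  "metric_proj C x = (THE p. p \<in> C \<and> (\<forall>y\<in>C. dist x p \<le> dist x y))"

definition strongly_monotone_wrt ::
    "real \<Rightarrow> ('a::{real_inner, complete_space} \<Rightarrow> 'a) \<Rightarrow> ('a \<Rightarrow> 'a) \<Rightarrow> bool" where
  "strongly_monotone_wrt \<alpha> g f \<longleftrightarrow>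
     0 < \<alpha> \<and> (\<forall>x y. (f x - f y) \<bullet> (g x - g y) \<ge> \<alpha> * (norm (x - y))\<^sup>2)"

definition strongly_monotone ::
    "real \<Rightarrow> ('a::{real_inner, complete_space} \<Rightarrow> 'a) \<Rightarrow> bool" where
  "strongly_monotone \<alpha> f \<longleftrightarrow>
     0 < \<alpha> \<and> (\<forall>x y. (f x - f y) \<bullet> (x - y) \<ge> \<alpha> * (norm (x - y))\<^sup>2)"

definition general_VI_solution ::
    "'a::{real_inner, complete_space} set \<Rightarrow> ('a \<Rightarrow> 'a) \<Rightarrow> ('a \<Rightarrow> 'a) \<Rightarrow> 'a \<Rightarrow> bool" where
  "general_VI_solution C f g x \<longleftrightarrow> g x \<in> C \<and> (\<forall>v\<in>C. f x \<bullet> (v - g x) \<ge> 0)"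

definition split_general_VI_solution ::
    "'a::{real_inner, complete_space} set \<Rightarrow> ('a \<Rightarrow> 'a) \<Rightarrow> ('a \<Rightarrow> 'a) \<Rightarrow>
     'b::{real_inner, complete_space} set \<Rightarrow> ('b \<Rightarrow> 'b) \<Rightarrow> ('b \<Rightarrow> 'b) \<Rightarrow>
     ('a \<Rightarrow> 'b) \<Rightarrow> 'a \<Rightarrow> bool" where
  "split_general_VI_solution C1 f1 g1 C2 f2 g2 A x \<longleftrightarrow>
     general_VI_solution C1 f1 g1 x \<and> general_VI_solution C2 f2 g2 (A x)"

end

theory Submission
  imports Defs
begin

text \<open>
  The solution \<open>xs\<close> is a fixed point of the scheme. The projection step contracts by
  \<open>\<theta>1 = sqrt ((\<delta>1\<^sup>2 - 2 * \<rho>1 * \<alpha>1 + \<rho>1\<^sup>2 * \<beta>1\<^sup>2) / (2 * \<sigma>1 + 1))\<close>, because the projection is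
  nonexpansive and \<open>g1\<close> expands distances by at least \<open>sqrt (2 * \<sigma>1 + 1)\<close>. The map
  \<open>u \<mapsto> u - \<gamma> A\<^sup>* (A u)\<close> is nonexpansive for \<open>\<gamma> \<le> 2 / \<parallel>A\<parallel>\<^sup>2\<close>, so the correction step expands by
  at most \<open>1 + 2 * \<theta>2\<close>. The condition on \<open>\<rho>1\<close> says precisely that \<open>\<theta>1 * (1 + 2 * \<theta>2) < 1\<close>, and
  divergence of the sum of the relaxation parameters then forces convergence.
\<close>

section \<open>Metric projection\<close>

lemma parallelogram_law:
  fixes a b :: "'a::real_inner"
  shows "(norm (a + b))\<^sup>2 + (norm (a - b))\<^sup>2 = 2 * (norm a)\<^sup>2 + 2 * (norm b)\<^sup>2"
  by (simp add: power2_norm_eq_inner algebra_simps)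

text \<open>A minimizing sequence is Cauchy: by convexity the midpoint of two terms lies in
  \<open>C\<close>, so it is no closer to \<open>x\<close> than the infimum \<open>d\<close>, and
  the parallelogram law then bounds the distance of the terms.\<close>

lemma exists_nearest_point:
  fixes C :: "'a::{real_inner, complete_space} set"
  assumes "C \<noteq> {}" "closed C" "convex C"
  shows "\<exists>p\<in>C. \<forall>y\<in>C. dist x p \<le> dist x y"
proof -
  define d where "d = infdist x C"
  have d0: "0 \<le> d" by (simp add: d_def infdist_nonneg)
  have dle: "d \<le> dist x y" if "y \<in> C" for y
    using that by (simp add: d_def infdist_le)
  have "\<exists>c\<in>C. dist x c < d + 1 / real (Suc n)" for n
  proof -
    have "Inf (dist x ` C) < d + 1 / real (Suc n)"
      using assms(1) by (simp add: d_def infdist_def)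
    then show ?thesis
      using assms(1) cInf_lessD[of "dist x ` C"] by auto
  qed
  then obtain c where c: "\<And>n. c n \<in> C" "\<And>n. dist x (c n) < d + 1 / real (Suc n)"
    by metis
  \<comment> \<open>The excess over \<open>d\<close> squared: (d + e)^2 - d^2 = (2d + e)e \<le> (2d
    + 1)e, as e = 1/(n+1) is at most 1.\<close>
  define s where "s n = (2 * d + 1) * (1 / real (Suc n))" for n
  have sq: "(dist x (c n))\<^sup>2 \<le> d\<^sup>2 + s n" for n
  proof -
    let ?e = "1 / real (Suc n)"
    have e: "0 < ?e" "?e \<le> 1" by auto
    have "(dist x (c n))\<^sup>2 \<le> (d + ?e)\<^sup>2"
      using c(2)[of n] by (intro power_mono) auto
    also have "\<dots> = d\<^sup>2 + (2 * d + ?e) * ?e"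
      by algebra
    also have "\<dots> \<le> d\<^sup>2 + s n"
      unfolding s_def using e by (intro add_left_mono mult_right_mono) linarith+
    finally show ?thesis .
  qed
  have near: "(dist (c m) (c n))\<^sup>2 \<le> 2 * s m + 2 * s n" for m n
  proof -
    have "(1/2) *\<^sub>R c m + (1/2) *\<^sub>R c n \<in> C"
      using assms(3) c(1) by (intro convexD) auto
    then have "d \<le> dist x ((1/2) *\<^sub>R c m + (1/2) *\<^sub>R c n)" by (rule dle)
    also have "\<dots> = norm ((1/2) *\<^sub>R ((x - c m) + (x - c n)))"
      by (simp add: dist_norm algebra_simps flip: scaleR_add_left)
    finally have "2 * d \<le> norm ((x - c m) + (x - c n))" by simp
    then have "(2 * d)\<^sup>2 \<le> (norm ((x - c m) + (x - c n)))\<^sup>2"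
      using d0 by (intro power_mono) auto
    moreover have "norm ((x - c m) - (x - c n)) = dist (c m) (c n)"
      by (simp add: dist_norm norm_minus_commute)
    ultimately show ?thesis
      using parallelogram_law[of "x - c m" "x - c n"] sq[of m] sq[of n]
      by (simp add: dist_norm power_mult_distrib)
  qed
  have s0: "s \<longlonglongrightarrow> 0"
    unfolding s_def by (intro tendsto_mult_right_zero LIMSEQ_Suc[OF lim_1_over_n])
  have "Cauchy c"
  proof (rule metric_CauchyI)
    fix e :: real assume "0 < e"
    \<comment> \<open>A quarter suffices because \<open>near\<close> sums 2 * \<open>s m\<close> and
      2 * \<open>s n\<close>.\<close>
    then have "eventually (\<lambda>n. s n < e\<^sup>2 / 4) sequentially"
      by (intro order_tendstoD(2)[OF s0]) auto
    then obtain N where N: "\<And>n. n \<ge> N \<Longrightarrow> s n < e\<^sup>2 / 4"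
      by (auto simp: eventually_sequentially)
    have "dist (c m) (c n) < e" if "m \<ge> N" "n \<ge> N" for m n
      using near[of m n] N[OF that(1)] N[OF that(2)] \<open>0 < e\<close>
      by (intro power2_less_imp_less[of _ e]) auto
    then show "\<exists>M. \<forall>m\<ge>M. \<forall>n\<ge>M. dist (c m) (c n) < e" by blast
  qed
  then obtain p where p: "c \<longlonglongrightarrow> p"
    using Cauchy_convergent convergent_def by blast
  have "p \<in> C" using assms(2) c(1) p closed_sequentially by blast
  have "(\<lambda>n. d + 1 / real (Suc n)) \<longlonglongrightarrow> d + 0"
    by (intro tendsto_add tendsto_const LIMSEQ_Suc[OF lim_1_over_n])
  then have "dist x p \<le> d + 0"
    using less_imp_le[OF c(2)] by (intro LIMSEQ_le[OF tendsto_dist[OF tendsto_const p]]) blast+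
  with \<open>p \<in> C\<close> dle show ?thesis by force
qed

text \<open>Pythagoras with an obtuse angle at \<open>p\<close>. The summand \<open>dist y p\<close>
  squared is kept because it yields uniqueness of the nearest point, not only minimality.\<close>

lemma variational_nearest_point:
  fixes C :: "'a::real_inner set"
  assumes "\<forall>y\<in>C. (x - p) \<bullet> (y - p) \<le> 0" "y \<in> C"
  shows "(dist x p)\<^sup>2 + (dist y p)\<^sup>2 \<le> (dist x y)\<^sup>2"
proof -
  have "x - y = (x - p) - (y - p)" by simp
  then have "(dist x y)\<^sup>2 = (dist x p)\<^sup>2 + (dist y p)\<^sup>2 - 2 * ((x - p) \<bullet> (y - p))"
    unfolding dist_norm using dot_norm_neg[of "x - p" "y - p"] by (simp add: field_simps)
  with assms show ?thesis by force
qed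

text \<open>Turns a variational inequality into a value of the projection, discharging the existence
  and uniqueness demanded by \<open>THE\<close>.\<close>

lemma metric_proj_eqI:
  assumes "p \<in> C" "\<forall>y\<in>C. (x - p) \<bullet> (y - p) \<le> 0"
  shows "metric_proj C x = p"
  unfolding metric_proj_def
proof (rule the_equality)
  have "dist x p \<le> dist x y" if "y \<in> C" for y
  proof (rule power2_le_imp_le)
    show "(dist x p)\<^sup>2 \<le> (dist x y)\<^sup>2"
      using variational_nearest_point[OF assms(2) that] zero_le_power2[of "dist y p"] by linarith
  qed simp
  with assms(1) show "p \<in> C \<and> (\<forall>y\<in>C. dist x p \<le> dist x y)" by blast
next
  fix q assume q: "q \<in> C \<and> (\<forall>y\<in>C. dist x q \<le> dist x y)"
  then have "(dist x q)\<^sup>2 \<le> (dist x p)\<^sup>2"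
    using assms(1) by (intro power_mono) auto
  with variational_nearest_point[OF assms(2) conjunct1[OF q]]
  have "(dist q p)\<^sup>2 \<le> 0" by linarith
  then show "q = p" by simp
qed

lemma
  fixes C :: "'a::{real_inner, complete_space} set"
  assumes "C \<noteq> {}" "closed C" "convex C"
  shows metric_proj_in: "metric_proj C x \<in> C"
    and metric_proj_variational: "y \<in> C \<Longrightarrow> (x - metric_proj C x) \<bullet> (y - metric_proj C x) \<le> 0"
proof -
  obtain p where p: "p \<in> C" "\<forall>y\<in>C. dist x p \<le> dist x y"
    using exists_nearest_point[OF assms] by blast
  note var = any_closest_point_dot[OF assms(3,2) p(1) _ p(2)]
  then have "metric_proj C x = p" by (intro metric_proj_eqI p(1)) blast
  with p(1) var show "metric_proj C x \<in> C"
    "y \<in> C \<Longrightarrow> (x - metric_proj C x) \<bullet> (y - metric_proj C x) \<le> 0" by auto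
qed

text \<open>Test the inequality at each projection with the other one and add: this gives |p - q|^2
  \<le> <a - b, p - q>. Cauchy-Schwarz and cancelling one factor |p - q| finish.\<close>

lemma metric_proj_nonexpansive:
  fixes C :: "'a::{real_inner, complete_space} set"
  assumes "C \<noteq> {}" "closed C" "convex C"
  shows "norm (metric_proj C a - metric_proj C b) \<le> norm (a - b)"
proof -
  define p q where "p = metric_proj C a" and "q = metric_proj C b"
  have "(a - p) \<bullet> (q - p) \<le> 0" "(b - q) \<bullet> (p - q) \<le> 0"
    unfolding p_def q_def using assms by (simp_all add: metric_proj_in metric_proj_variational)
  then have "(p - q) \<bullet> (p - q) \<le> (a - b) \<bullet> (p - q)"
    by (simp add: algebra_simps inner_commute)
  also have "\<dots> \<le> norm (a - b) * norm (p - q)" by (rule norm_cauchy_schwarz)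
  finally have "norm (p - q) * norm (p - q) \<le> norm (a - b) * norm (p - q)"
    by (simp add: norm_eq_square power2_norm_eq_inner flip: power2_eq_square)
  then show ?thesis unfolding p_def[symmetric] q_def[symmetric]
    by (cases "p = q") auto
qed

section \<open>Adjoints in Hilbert spaces\<close>

text \<open>The projection of the origin onto the hyperplane \<open>{u. f u = 1}\<close> is normal to the kernel.\<close>

theorem riesz_representation:
  fixes f :: "'a::{real_inner, complete_space} \<Rightarrow> real"
  assumes "bounded_linear f"
  shows "\<exists>r. \<forall>v. f v = v \<bullet> r"
proof (cases "\<forall>v. f v = 0")
  case True
  then show ?thesis by (intro exI[of _ 0]) auto
next
  case False
  interpret f: bounded_linear f by fact
  define C where "C = {u. f u = 1}"
  from False obtain a where "f a \<noteq> 0" by blast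
  then have "f (inverse (f a) *\<^sub>R a) = 1" by (simp add: f.scaleR)
  then have "C \<noteq> {}" by (auto simp: C_def)
  moreover have "closed C"
    unfolding C_def by (intro closed_Collect_eq f.continuous_on continuous_on_id continuous_on_const)
  moreover have "convex C"
    by (auto simp: C_def convex_def f.add f.scaleR)
  ultimately obtain p where p: "p \<in> C" "\<And>y. y \<in> C \<Longrightarrow> (0 - p) \<bullet> (y - p) \<le> 0"
    using metric_proj_in metric_proj_variational by metis
  have fp: "f p = 1" using p(1) by (simp add: C_def)
  then have "p \<noteq> 0" using f.zero by force
  have "f v = v \<bullet> (inverse (p \<bullet> p) *\<^sub>R p)" for v
  proof -
    \<comment> \<open>The component of \<open>v\<close> in the kernel of \<open>f\<close>. Both p +
      h and p - h stay in the hyperplane, so two opposite inequalities force \<open>p\<close> to be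
      orthogonal to h.\<close>
    let ?h = "v - f v *\<^sub>R p"
    have "f ?h = 0" by (simp add: f.diff f.scaleR fp)
    then have "p + ?h \<in> C" "p - ?h \<in> C" by (simp_all add: C_def f.add f.diff fp f.scaleR)
    from p(2)[OF this(1)] p(2)[OF this(2)] have "p \<bullet> ?h = 0"
      by (simp add: inner_diff_right)
    then have "p \<bullet> v = f v * (p \<bullet> p)" by (simp add: inner_diff_right)
    with \<open>p \<noteq> 0\<close> show ?thesis by (simp add: inner_commute)
  qed
  then show ?thesis by blast
qed

text \<open>\<open>adjoint\<close> is a choice operator, so its defining identity holds once some
  candidate exists; Riesz supplies one value for each \<open>w\<close>.\<close>

lemma hilbert_adjoint_works:
  fixes A :: "'a::{real_inner, complete_space} \<Rightarrow> 'b::real_inner"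
  assumes "bounded_linear A"
  shows "v \<bullet> adjoint A w = A v \<bullet> w"
proof -
  have "\<exists>r. \<forall>v. A v \<bullet> w = v \<bullet> r" for w
    by (intro riesz_representation bounded_linear_compose[OF bounded_linear_inner_left assms])
  then have "\<exists>f'. \<forall>v w. A v \<bullet> w = v \<bullet> f' w" by metis
  then show ?thesis unfolding adjoint_def by (rule someI2_ex) simp
qed

lemma hilbert_adjoint_diff:
  fixes A :: "'a::{real_inner, complete_space} \<Rightarrow> 'b::real_inner"
  assumes "bounded_linear A"
  shows "adjoint A (v - w) = adjoint A v - adjoint A w"
  by (subst vector_eq_ldot[symmetric])
    (simp add: hilbert_adjoint_works[OF assms] inner_diff_right)

text \<open>Apply the adjoint identity to \<open>adjoint A w\<close> itself, then cancel one factor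
  of its norm.\<close>

lemma norm_hilbert_adjoint_le:
  fixes A :: "'a::{real_inner, complete_space} \<Rightarrow> 'b::real_inner"
  assumes "bounded_linear A"
  shows "norm (adjoint A w) \<le> onorm A * norm w"
proof -
  let ?r = "adjoint A w"
  have "norm ?r * norm ?r = A ?r \<bullet> w"
    by (simp add: hilbert_adjoint_works[OF assms, symmetric] power2_norm_eq_inner flip: power2_eq_square)
  also have "\<dots> \<le> norm (A ?r) * norm w" by (rule norm_cauchy_schwarz)
  also have "\<dots> \<le> (onorm A * norm ?r) * norm w"
    by (intro mult_right_mono onorm assms) auto
  finally have "norm ?r * norm ?r \<le> (onorm A * norm w) * norm ?r" by (simp add: mult_ac)
  then show ?thesis
    using onorm_pos_le[OF assms] by (cases "?r = 0") auto
qed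

text \<open>In the expanded square the cross term is -2\<gamma>|Au|^2, and the bound on \<gamma>
  keeps the quadratic term at most 2\<gamma>|Au|^2.\<close>

lemma norm_diff_adjoint_compose_le:
  fixes A :: "'a::{real_inner, complete_space} \<Rightarrow> 'b::real_inner"
  assumes "bounded_linear A" "0 \<le> \<gamma>" "\<gamma> * (onorm A)\<^sup>2 \<le> 2"
  shows "norm (u - \<gamma> *\<^sub>R adjoint A (A u)) \<le> norm u"
proof -
  let ?r = "adjoint A (A u)"
  have "(norm ?r)\<^sup>2 \<le> (onorm A * norm (A u))\<^sup>2"
    by (intro power_mono norm_hilbert_adjoint_le assms(1)) auto
  then have "\<gamma> * (norm ?r)\<^sup>2 \<le> \<gamma> * (onorm A)\<^sup>2 * (norm (A u))\<^sup>2"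
    using assms(2) by (simp add: mult_left_mono power_mult_distrib mult.assoc)
  also have "\<dots> \<le> 2 * (norm (A u))\<^sup>2" by (intro mult_right_mono assms(3)) auto
  finally have "\<gamma> * (\<gamma> * (norm ?r)\<^sup>2) \<le> \<gamma> * (2 * (norm (A u))\<^sup>2)"
    using assms(2) by (rule mult_left_mono)
  moreover have "(norm (u - \<gamma> *\<^sub>R ?r))\<^sup>2
      = (norm u)\<^sup>2 - 2 * \<gamma> * (u \<bullet> ?r) + \<gamma> * (\<gamma> * (norm ?r)\<^sup>2)"
    by (simp add: power2_norm_eq_inner algebra_simps inner_commute)
  moreover have "u \<bullet> ?r = (norm (A u))\<^sup>2"
    by (simp add: hilbert_adjoint_works[OF assms(1)] power2_norm_eq_inner)
  ultimately have "(norm (u - \<gamma> *\<^sub>R ?r))\<^sup>2 \<le> (norm u)\<^sup>2" by simp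
  then show ?thesis by (rule power2_le_imp_le) simp
qed

section \<open>General variational inequalities\<close>

text \<open>Write g = (g - I) + I and expand the square: the cross term contributes 2\<sigma>, the
  identity 1, and the square of the g - I part is dropped.\<close>

lemma strongly_monotone_diff_id_expansive:
  assumes "strongly_monotone \<sigma> (\<lambda>u. g u - u)"
  shows "(2 * \<sigma> + 1) * (norm (u - v))\<^sup>2 \<le> (norm (g u - g v))\<^sup>2"
proof -
  let ?h = "(g u - u) - (g v - v)"
  have "\<sigma> * (norm (u - v))\<^sup>2 \<le> ?h \<bullet> (u - v)"
    using assms by (simp add: strongly_monotone_def)
  moreover have "g u - g v = ?h + (u - v)" by simp
  then have "(norm (g u - g v))\<^sup>2 = (norm ?h)\<^sup>2 + 2 * (?h \<bullet> (u - v)) + (norm (u - v))\<^sup>2"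
    using dot_norm[of ?h "u - v"] by simp
  ultimately show ?thesis
    using zero_le_power2[of "norm ?h"] unfolding distrib_right mult.assoc by linarith
qed

text \<open>The displacement from \<open>g x\<close> to the projected point is -\<rho> times
  \<open>f x\<close>, so the variational inequality is the obtuse-angle criterion scaled by
  \<rho>.\<close>

lemma general_VI_solution_imp_fixpoint:
  assumes "general_VI_solution C f g x" "0 < \<rho>"
  shows "g x = metric_proj C (g x - \<rho> *\<^sub>R f x)"
  using assms by (intro metric_proj_eqI[symmetric]) (auto simp: general_VI_solution_def)

text \<open>Serves both problems. Nonexpansiveness compares the forward steps; in their squared
  distance the Lipschitz bounds control the two squares and relative monotonicity the cross term.
  Expansiveness of \<open>g\<close> then passes from \<open>g y - g xs\<close> to
  \<open>y - xs\<close>.\<close>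

lemma projection_step_le:
  fixes C :: "'a::{real_inner, complete_space} set"
  assumes C: "C \<noteq> {}" "closed C" "convex C"
    and f: "strongly_monotone_wrt \<alpha> g f" "lipschitz_on \<beta> UNIV f"
    and g: "lipschitz_on \<delta> UNIV g" "strongly_monotone \<sigma> (\<lambda>u. g u - u)"
    and sol: "general_VI_solution C f g xs" and \<rho>: "0 < \<rho>"
    and step: "g y = metric_proj C (g x - \<rho> *\<^sub>R f x)"
  shows "norm (y - xs) \<le> sqrt ((\<delta>\<^sup>2 - 2 * \<rho> * \<alpha> + \<rho>\<^sup>2 * \<beta>\<^sup>2) / (2 * \<sigma> + 1)) * norm (x - xs)"
proof -
  let ?d = "(norm (x - xs))\<^sup>2"
  have \<sigma>: "0 < 2 * \<sigma> + 1" using g(2) by (simp add: strongly_monotone_def)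
  have "norm (g x - g xs) \<le> \<delta> * norm (x - xs)"
    by (rule lipschitz_on_normD[OF g(1)]) auto
  from power_mono[OF this, of 2] have G: "(norm (g x - g xs))\<^sup>2 \<le> \<delta>\<^sup>2 * ?d"
    by (simp add: power_mult_distrib)
  have "norm (f x - f xs) \<le> \<beta> * norm (x - xs)"
    by (rule lipschitz_on_normD[OF f(2)]) auto
  from power_mono[OF this, of 2] have "(norm (f x - f xs))\<^sup>2 \<le> \<beta>\<^sup>2 * ?d"
    by (simp add: power_mult_distrib)
  then have F: "\<rho>\<^sup>2 * (norm (f x - f xs))\<^sup>2 \<le> \<rho>\<^sup>2 * (\<beta>\<^sup>2 * ?d)"
    by (intro mult_left_mono) auto
  have "\<alpha> * ?d \<le> (f x - f xs) \<bullet> (g x - g xs)"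
    using f(1) by (simp add: strongly_monotone_wrt_def)
  then have FG: "2 * \<rho> * (\<alpha> * ?d) \<le> 2 * \<rho> * ((f x - f xs) \<bullet> (g x - g xs))"
    using \<rho> by (intro mult_left_mono) auto
  have "norm (g y - g xs) \<le> norm ((g x - \<rho> *\<^sub>R f x) - (g xs - \<rho> *\<^sub>R f xs))"
    using metric_proj_nonexpansive[OF C] step general_VI_solution_imp_fixpoint[OF sol \<rho>] by metis
  also have "(g x - \<rho> *\<^sub>R f x) - (g xs - \<rho> *\<^sub>R f xs) = (g x - g xs) - \<rho> *\<^sub>R (f x - f xs)"
    by (simp add: algebra_simps)
  finally have "(norm (g y - g xs))\<^sup>2 \<le> (norm ((g x - g xs) - \<rho> *\<^sub>R (f x - f xs)))\<^sup>2"
    by (rule power_mono) simp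
  also have "\<dots> = (norm (g x - g xs))\<^sup>2 - 2 * \<rho> * ((f x - f xs) \<bullet> (g x - g xs))
      + \<rho>\<^sup>2 * (norm (f x - f xs))\<^sup>2"
    by (simp add: power2_norm_eq_inner power2_eq_square[of \<rho>] algebra_simps inner_commute)
  also have "\<dots> \<le> (\<delta>\<^sup>2 - 2 * \<rho> * \<alpha> + \<rho>\<^sup>2 * \<beta>\<^sup>2) * ?d"
    using G F FG by (simp add: algebra_simps)
  finally have "(2 * \<sigma> + 1) * (norm (y - xs))\<^sup>2 \<le> (\<delta>\<^sup>2 - 2 * \<rho> * \<alpha> + \<rho>\<^sup>2 * \<beta>\<^sup>2) * ?d"
    using strongly_monotone_diff_id_expansive[OF g(2), of y xs] by linarith
  then have "(norm (y - xs))\<^sup>2 \<le> (\<delta>\<^sup>2 - 2 * \<rho> * \<alpha> + \<rho>\<^sup>2 * \<beta>\<^sup>2) / (2 * \<sigma> + 1) * ?d"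
    using \<sigma> by (simp add: field_simps)
  from real_sqrt_le_mono[OF this] show ?thesis by (simp only: real_sqrt_mult) simp
qed

section \<open>Convergence\<close>

text \<open>Since 1 - t \<le> exp(-t), the product of the factors is at most the exponential of
  minus c times the divergent partial sum.\<close>

lemma relaxed_contraction_tendsto_0:
  fixes e a :: "nat \<Rightarrow> real"
  assumes e: "\<And>n. 0 \<le> e n" "\<And>n. e (Suc n) \<le> (1 - c * a n) * e n" and c: "0 < c"
    and a: "filterlim (\<lambda>N. \<Sum>n=1..N. a n) at_top sequentially"
  shows "e \<longlonglongrightarrow> 0"
proof -
  \<comment> \<open>The sums start at index 1, so the recursion is unrolled down to
    \<open>e 1\<close>; for N = 0 the sum is empty.\<close>
  have bound: "e (Suc N) \<le> e 1 * exp (- (c * (\<Sum>n=1..N. a n)))" for N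
  proof (induction N)
    case (Suc N)
    have "e (Suc (Suc N)) \<le> (1 - c * a (Suc N)) * e (Suc N)" by (rule e(2))
    also have "\<dots> \<le> exp (- (c * a (Suc N))) * e (Suc N)"
      using exp_ge_add_one_self[of "- (c * a (Suc N))"] by (intro mult_right_mono e(1)) simp
    also have "\<dots> \<le> exp (- (c * a (Suc N))) * (e 1 * exp (- (c * (\<Sum>n=1..N. a n))))"
      by (intro mult_left_mono Suc.IH) simp
    also have "\<dots> = e 1 * exp (- (c * (\<Sum>n=1..Suc N. a n)))"
      by (simp add: algebra_simps exp_add[symmetric])
    finally show ?case .
  qed simp
  have "filterlim (\<lambda>N. c * (\<Sum>n=1..N. a n)) at_top sequentially"
    by (rule filterlim_tendsto_pos_mult_at_top[OF tendsto_const c a])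
  then have "(\<lambda>N. exp (- (c * (\<Sum>n=1..N. a n)))) \<longlonglongrightarrow> 0"
    by (intro filterlim_compose[OF exp_at_bot] filterlim_compose[OF filterlim_uminus_at_bot_at_top])
  then have "(\<lambda>N. e 1 * exp (- (c * (\<Sum>n=1..N. a n)))) \<longlonglongrightarrow> 0"
    by (rule tendsto_mult_right_zero)
  then have "(\<lambda>N. e (Suc N)) \<longlonglongrightarrow> 0"
    by (rule tendsto_sandwich[OF _ _ tendsto_const, rotated 2]) (use e(1) bound in auto)
  then show ?thesis by (rule LIMSEQ_imp_Suc)
qed

text \<open>The hypothesis is the conclusion with the square in \<rho> completed: multiply by
  \<beta>^2, square, and cancel \<alpha>^2.\<close>

lemma step_size_condition:
  fixes \<alpha> \<beta> \<delta> \<rho> k :: real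
  assumes "0 < \<beta>" "\<bar>\<rho> - \<alpha> / \<beta>\<^sup>2\<bar> < sqrt (\<alpha>\<^sup>2 - \<beta>\<^sup>2 * (\<delta>\<^sup>2 - k\<^sup>2)) / \<beta>\<^sup>2"
  shows "\<delta>\<^sup>2 - 2 * \<rho> * \<alpha> + \<rho>\<^sup>2 * \<beta>\<^sup>2 < k\<^sup>2"
proof -
  let ?D = "\<alpha>\<^sup>2 - \<beta>\<^sup>2 * (\<delta>\<^sup>2 - k\<^sup>2)"
  have "\<rho> * \<beta>\<^sup>2 - \<alpha> = (\<rho> - \<alpha> / \<beta>\<^sup>2) * \<beta>\<^sup>2"
    using assms(1) by (simp add: left_diff_distrib)
  then have "\<bar>\<rho> * \<beta>\<^sup>2 - \<alpha>\<bar> = \<bar>\<rho> - \<alpha> / \<beta>\<^sup>2\<bar> * \<beta>\<^sup>2"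
    by (simp only: abs_mult abs_power2)
  also have "\<dots> < sqrt ?D"
    using assms by (simp add: pos_less_divide_eq)
  finally have less: "\<bar>\<rho> * \<beta>\<^sup>2 - \<alpha>\<bar> < sqrt ?D" .
  \<comment> \<open>Secures ?D > 0, so that squaring the root returns ?D.\<close>
  then have "0 < sqrt ?D" by linarith
  have "\<bar>\<rho> * \<beta>\<^sup>2 - \<alpha>\<bar>\<^sup>2 < (sqrt ?D)\<^sup>2"
    using less by (intro power_strict_mono) auto
  then have "(\<rho> * \<beta>\<^sup>2 - \<alpha>)\<^sup>2 < ?D" using \<open>0 < sqrt ?D\<close> by simp
  then have "\<beta>\<^sup>2 * (\<delta>\<^sup>2 - 2 * \<rho> * \<alpha> + \<rho>\<^sup>2 * \<beta>\<^sup>2) < \<beta>\<^sup>2 * k\<^sup>2"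
    by (simp add: power2_eq_square algebra_simps)
  then show ?thesis using assms(1) by simp
qed

theorem corollary3p2:
  fixes C1 :: "'a::{real_inner, complete_space} set"
    and C2 :: "'b::{real_inner, complete_space} set"
    and f1 g1 :: "'a \<Rightarrow> 'a"
    and f2 g2 :: "'b \<Rightarrow> 'b"
    and A :: "'a \<Rightarrow> 'b"
    and \<alpha>1 \<beta>1 \<delta>1 \<sigma>1 \<alpha>2 \<beta>2 \<delta>2 \<sigma>2 \<rho>1 \<rho>2 \<gamma> k1 \<theta>2 :: real
    and \<alpha> :: "nat \<Rightarrow> real"
    and xs :: 'a
    and x y :: "nat \<Rightarrow> 'a"
    and z :: "nat \<Rightarrow> 'b"
  assumes "C1 \<noteq> {}" "closed C1" "convex C1"
    and "C2 \<noteq> {}" "closed C2" "convex C2"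
    and "strongly_monotone_wrt \<alpha>1 g1 f1"
    and "0 < \<beta>1" "lipschitz_on \<beta>1 UNIV f1"
    and "0 < \<delta>1" "lipschitz_on \<delta>1 UNIV g1"
    and "strongly_monotone \<sigma>1 (\<lambda>u. g1 u - u)"
    and "strongly_monotone_wrt \<alpha>2 g2 f2"
    and "0 < \<beta>2" "lipschitz_on \<beta>2 UNIV f2"
    and "0 < \<delta>2" "lipschitz_on \<delta>2 UNIV g2"
    and "strongly_monotone \<sigma>2 (\<lambda>u. g2 u - u)"
    and "bounded_linear A"
    and "split_general_VI_solution C1 f1 g1 C2 f2 g2 A xs"
    and "\<And>n. 0 < \<alpha> n \<and> \<alpha> n < 1"
    and "filterlim (\<lambda>N. \<Sum>n=1..N. \<alpha> n) at_top sequentially"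
    and "0 < \<rho>1" "0 < \<rho>2" "0 < \<gamma>"
    and "\<And>n. g1 (y n) = metric_proj C1 (g1 (x n) - \<rho>1 *\<^sub>R f1 (x n))"
    and "\<And>n. g2 (z n) = metric_proj C2 (g2 (A (y n)) - \<rho>2 *\<^sub>R f2 (A (y n)))"
    and "\<And>n. x (Suc n) =
           (1 - \<alpha> n) *\<^sub>R x n + \<alpha> n *\<^sub>R (y n + \<gamma> *\<^sub>R adjoint A (z n - A (y n)))"
    and "\<bar>\<rho>1 - \<alpha>1 / \<beta>1\<^sup>2\<bar> < sqrt (\<alpha>1\<^sup>2 - \<beta>1\<^sup>2 * (\<delta>1\<^sup>2 - k1\<^sup>2)) / \<beta>1\<^sup>2"
    and "\<alpha>1 > \<beta>1 * sqrt (\<delta>1\<^sup>2 - k1\<^sup>2)"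
    and "k1 = sqrt (2 * \<sigma>1 + 1) / (1 + 2 * \<theta>2)"
    and "\<delta>1 > \<bar>k1\<bar>"
    and "\<theta>2 = sqrt ((\<delta>2\<^sup>2 - 2 * \<rho>2 * \<alpha>2 + \<rho>2\<^sup>2 * \<beta>2\<^sup>2) / (2 * \<sigma>2 + 1))"
    and "0 < \<theta>2"
    and "onorm A \<noteq> 0 \<longrightarrow> \<gamma> < 2 / (onorm A)\<^sup>2"
  shows "x \<longlonglongrightarrow> xs"
proof -
  note A = \<open>bounded_linear A\<close>
  have \<sigma>1: "0 < \<sigma>1" using assms(12) by (simp add: strongly_monotone_def)
  have sol1: "general_VI_solution C1 f1 g1 xs" and sol2: "general_VI_solution C2 f2 g2 (A xs)"
    using assms(20) by (simp_all add: split_general_VI_solution_def)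
  have \<gamma>A: "\<gamma> * (onorm A)\<^sup>2 \<le> 2"
    using assms(35) by (cases "onorm A = 0") (auto simp: pos_less_divide_eq)
  define \<theta>1 where "\<theta>1 = sqrt ((\<delta>1\<^sup>2 - 2 * \<rho>1 * \<alpha>1 + \<rho>1\<^sup>2 * \<beta>1\<^sup>2) / (2 * \<sigma>1 + 1))"
  \<comment> \<open>The factor of one unrelaxed step: \<theta>1 from the first projection, 1 +
    2\<theta>2 from the correction through \<open>A\<close>.\<close>
  define \<theta> where "\<theta> = (1 + 2 * \<theta>2) * \<theta>1"
  have y_le: "norm (y n - xs) \<le> \<theta>1 * norm (x n - xs)" for n
    unfolding \<theta>1_def
    by (rule projection_step_le[OF assms(1-3) assms(7,9,11,12) sol1 assms(23) assms(26)])
  have z_le: "norm (z n - A xs) \<le> \<theta>2 * norm (A (y n) - A xs)" for n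
    unfolding \<open>\<theta>2 = _\<close>
    by (rule projection_step_le[OF assms(4-6) assms(13,15,17,18) sol2 assms(24) assms(27)])
  have correction_le: "norm (y n + \<gamma> *\<^sub>R adjoint A (z n - A (y n)) - xs) \<le> \<theta> * norm (x n - xs)" for n
  proof -
    let ?u = "y n - xs"
    \<comment> \<open>Inserting \<open>A xs\<close> splits the correction into the nonexpansive part
      acting on \<open>?u\<close> and the error of \<open>z n\<close>.\<close>
    have "adjoint A (z n - A (y n)) = adjoint A ((z n - A xs) - A ?u)"
      using A by (simp add: linear_diff bounded_linear.linear)
    then have "y n + \<gamma> *\<^sub>R adjoint A (z n - A (y n)) - xs
        = (?u - \<gamma> *\<^sub>R adjoint A (A ?u)) + \<gamma> *\<^sub>R adjoint A (z n - A xs)"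
      by (simp only: hilbert_adjoint_diff[OF A] scaleR_diff_right) simp
    also have "norm \<dots> \<le> norm ?u + \<gamma> * norm (adjoint A (z n - A xs))"
      using norm_diff_adjoint_compose_le[OF A _ \<gamma>A, of ?u] \<open>0 < \<gamma>\<close>
      by (intro norm_triangle_le) simp
    also have "\<dots> \<le> norm ?u + 2 * \<theta>2 * norm ?u"
    proof -
      have "norm (A (y n) - A xs) \<le> onorm A * norm ?u"
        using onorm[OF A, of ?u] A by (simp add: linear_diff bounded_linear.linear)
      then have "\<theta>2 * norm (A (y n) - A xs) \<le> \<theta>2 * (onorm A * norm ?u)"
        using \<open>0 < \<theta>2\<close> by (intro mult_left_mono) auto
      with z_le[of n] have "norm (z n - A xs) \<le> \<theta>2 * (onorm A * norm ?u)" by linarith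
      then have "onorm A * norm (z n - A xs) \<le> onorm A * (\<theta>2 * (onorm A * norm ?u))"
        by (intro mult_left_mono onorm_pos_le A)
      with norm_hilbert_adjoint_le[OF A, of "z n - A xs"]
      have "norm (adjoint A (z n - A xs)) \<le> onorm A * (\<theta>2 * (onorm A * norm ?u))" by linarith
      then have "\<gamma> * norm (adjoint A (z n - A xs)) \<le> \<gamma> * (onorm A * (\<theta>2 * (onorm A * norm ?u)))"
        using \<open>0 < \<gamma>\<close> by (intro mult_left_mono) auto
      \<comment> \<open>One factor \<open>onorm A\<close> comes from the adjoint, the other from
        \<open>A\<close>; with \<gamma> their product is at most 2, the source of the 2 in 1 +
        2\<theta>2.\<close>
      also have "\<dots> = (\<gamma> * (onorm A)\<^sup>2) * (\<theta>2 * norm ?u)" by (simp add: power2_eq_square)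
      also have "\<dots> \<le> 2 * (\<theta>2 * norm ?u)"
        using \<open>0 < \<theta>2\<close> by (intro mult_right_mono \<gamma>A) auto
      finally show ?thesis by simp
    qed
    also have "\<dots> = (1 + 2 * \<theta>2) * norm ?u" by (simp add: algebra_simps)
    also have "\<dots> \<le> (1 + 2 * \<theta>2) * (\<theta>1 * norm (x n - xs))"
      using \<open>0 < \<theta>2\<close> by (intro mult_left_mono y_le) auto
    finally show ?thesis by (simp add: \<theta>_def mult.assoc)
  qed
  have "\<theta>1 < sqrt (k1\<^sup>2 / (2 * \<sigma>1 + 1))"
    unfolding \<theta>1_def using \<sigma>1 step_size_condition[OF assms(8,29)]
    by (intro real_sqrt_less_mono divide_strict_right_mono) auto
  \<comment> \<open>The form of \<open>k1\<close> is chosen for this: the expansion constant of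
    \<open>g1\<close> cancels and the reciprocal of the correction factor remains.\<close>
  also have "k1\<^sup>2 / (2 * \<sigma>1 + 1) = (1 / (1 + 2 * \<theta>2))\<^sup>2"
    using \<sigma>1 by (simp add: \<open>k1 = _\<close> power_divide)
  finally have "\<theta>1 < 1 / (1 + 2 * \<theta>2)" using \<open>0 < \<theta>2\<close> by simp
  then have "\<theta> < 1"
    using \<open>0 < \<theta>2\<close> by (simp add: \<theta>_def pos_less_divide_eq mult.commute)
  have "norm (x (Suc n) - xs) \<le> (1 - (1 - \<theta>) * \<alpha> n) * norm (x n - xs)" for n
  proof -
    let ?w = "y n + \<gamma> *\<^sub>R adjoint A (z n - A (y n))"
    have \<alpha>: "0 < \<alpha> n" "\<alpha> n < 1" using assms(21) by auto
    \<comment> \<open>\<open>xs\<close> is split with the same convex weights, so the relaxed step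
      contracts by 1 - (1 - \<theta>)\<alpha>.\<close>
    have "x (Suc n) - xs = (1 - \<alpha> n) *\<^sub>R (x n - xs) + \<alpha> n *\<^sub>R (?w - xs)"
      by (simp add: assms(28) algebra_simps)
    also have "norm \<dots> \<le> (1 - \<alpha> n) * norm (x n - xs) + \<alpha> n * norm (?w - xs)"
      using \<alpha> norm_triangle_ineq[of "(1 - \<alpha> n) *\<^sub>R (x n - xs)"] by (metis abs_of_pos diff_gt_0_iff_gt norm_scaleR)
    also have "\<dots> \<le> (1 - \<alpha> n) * norm (x n - xs) + \<alpha> n * (\<theta> * norm (x n - xs))"
      using \<alpha> by (intro add_left_mono mult_left_mono correction_le) auto
    finally show ?thesis by (simp add: algebra_simps)
  qed
  then have "(\<lambda>n. norm (x n - xs)) \<longlonglongrightarrow> 0"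
    using \<open>\<theta> < 1\<close>
    by (intro relaxed_contraction_tendsto_0[where c = "1 - \<theta>" and a = \<alpha>] assms(22)) auto
  then show ?thesis by (simp add: LIM_zero_iff tendsto_norm_zero_iff)
qed

end
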